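(* Let $X=(x_1,\dots,x_p)\in\mathbb{R}^{n\times p}$ be a design matrix and $y\in\mathbb{R}^n$ a response vector. Let $\widehat\beta=\widehat\beta(\lambda)$ be a lasso solution path, that is, a solution path of the Karush--Kuhn--Tucker conditions given in the context. Consider the penalized joint loss function $$L_{\lambda_0}(\beta,\sigma)=\frac{|y-X\beta|_2^2}{2n\sigma}+\frac{(1-a)\sigma}{2}+\lambda_0|\beta|_1 .$$ Then $L_{\lambda_0}(\beta,\sigma)$ is jointly convex in $(\beta,\sigma)$, and the iterative algorithm $$\widehat\sigma\leftarrow |y-X\widehat\beta^{\mathrm{old}}|_2/\{(1-a)n\}^{1/2},\qquad \lambda\leftarrow\widehat\sigma\lambda_0,\qquad \widehat\beta\leftarrow\widehat\beta^{\mathrm{new}}=\widehat\beta(\lambda)$$ converges to $$(\widehat\beta,\widehat\sigma)=\arg\min_{\beta,\sigma}L_{\lambda_0}(\beta,\sigma).$$ The resulting estimators $\widehat\beta=\widehat\beta(X,y)$ and $\widehat\sigma=\widehat\sigma(X,y)$ are scale equivariant in $y$ in the sense that $\widehat\beta(X,cy)=c\,\widehat\beta(X,y)$ and $\widehat\sigma(X,cy)=|c|\,\widehat\sigma(X,y)$. Moreover, $$\frac{\partial}{\partial\sigma}L_{\lambda_0}\{\widehat\beta(\sigma\lambda_0),\sigma\}=\frac{1-a}{2}-\frac{|y-X\widehat\beta(\sigma\lambda_0)|_2^2}{2n\sigma^2}.$$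
   Context: $|v|_q$ is the $\ell_q$ norm. $\lambda_0$ is a prefixed penalty level not depending on the noise level $\sigma$, and $a\ge0$ is a constant that provides an option for a degrees-of-freedom adjustment. The argument $\sigma$ of the loss is a (positive) noise level and $\beta\in\mathbb{R}^p$. A lasso solution path is a path $\lambda\mapsto\widehat\beta(\lambda)\in\mathbb{R}^p$ (a linear spline in $\lambda$, beginning from $\widehat\beta(\lambda)=0$ at $\lambda=|X'y/n|_\infty$) such that $\widehat\beta=\widehat\beta(\lambda)$ satisfies the Karush--Kuhn--Tucker conditions for minimizing $|y-X\beta|_2^2/(2n)+\lambda|\beta|_1$ over $\beta$: $x_j'(y-X\widehat\beta)/n=\lambda\,\mathrm{sgn}(\widehat\beta_j)$ if $\widehat\beta_j\ne0$, and $x_j'(y-X\widehat\beta)/n\in\lambda[-1,1]$ if $\widehat\beta_j=0$. In each step of the algorithm, $\widehat\beta^{\mathrm{old}}$ is the current value of $\widehat\beta$.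
   Formalization: Takes λ0>0, and a<1 for the algorithm; the limit is an arg min over σ>0 if one exists and the start has y≠Xβ. Equivariance of the output uses the start scaled by c and, for β̂, the rescaled path; if the arg min is unique and c≠0, any path and any start with nonzero residual. *)

theory Defs
  imports "HOL-Analysis.Analysis"
begin

text \<open>
  The design matrix is \<open>X :: real^'p^'n\<close> (rows are observations, \<open>column j X\<close> is \<open>x\<^sub>j\<close>), so that
  \<open>n = CARD('n)\<close> and \<open>p = CARD('p)\<close>; \<open>norm\<close> is the Euclidean norm and \<open>infnorm\<close> the maximum norm.
\<close>

definition l1norm :: "real^'p \<Rightarrow> real" where
  "l1norm b = (\<Sum>j\<in>UNIV. \<bar>b $ j\<bar>)"

definition scaled_loss ::
    "real^'p^'n \<Rightarrow> real^'n \<Rightarrow> real \<Rightarrow> real \<Rightarrow> real^'p \<Rightarrow> real \<Rightarrow> real" where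
  "scaled_loss X y lam0 a b s =
     (norm (y - X *v b))\<^sup>2 / (2 * real CARD('n) * s) + (1 - a) * s / 2 + lam0 * l1norm b"

text \<open>The noise level argument of the loss ranges over the positive reals.\<close>

definition scaled_argmin ::
    "real^'p^'n \<Rightarrow> real^'n \<Rightarrow> real \<Rightarrow> real \<Rightarrow> ((real^'p) \<times> real) set" where
  "scaled_argmin X y lam0 a =
     {m. is_arg_min (\<lambda>(b, s). scaled_loss X y lam0 a b s) (\<lambda>(b, s). s > 0) m}"

definition lasso_kkt :: "real^'p^'n \<Rightarrow> real^'n \<Rightarrow> real \<Rightarrow> real^'p \<Rightarrow> bool" where
  "lasso_kkt X y lam b \<longleftrightarrow>
     (\<forall>j. (b $ j \<noteq> 0 \<longrightarrow>
             (column j X \<bullet> (y - X *v b)) / real CARD('n) = lam * sgn (b $ j)) \<and>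
          (b $ j = 0 \<longrightarrow>
             (column j X \<bullet> (y - X *v b)) / real CARD('n) \<in> (\<lambda>t. lam * t) ` {-1..1}))"

text \<open>Continuous and affine between consecutive elements of a finite set of knots.\<close>

definition linear_spline_on :: "real set \<Rightarrow> (real \<Rightarrow> 'a::real_normed_vector) \<Rightarrow> bool" where
  "linear_spline_on S f \<longleftrightarrow>
     continuous_on S f \<and>
     (\<exists>K. finite K \<and>
       (\<forall>u v. u \<le> v \<and> {u..v} \<subseteq> S \<and> {u<..<v} \<inter> K = {} \<longrightarrow>
          (\<exists>A B. \<forall>t\<in>{u..v}. f t = A + t *\<^sub>R B)))"

text \<open>
  The path is a function on all penalty levels \<open>lam \<ge> 0\<close>, because the iteration below may visit
  levels above the starting point of the path (where the KKT conditions force the value \<open>0\<close>).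
\<close>

definition lasso_path :: "real^'p^'n \<Rightarrow> real^'n \<Rightarrow> (real \<Rightarrow> real^'p) \<Rightarrow> bool" where
  "lasso_path X y B \<longleftrightarrow>
     linear_spline_on {0..} B \<and>
     B (infnorm ((1 / real CARD('n)) *\<^sub>R (transpose X *v y))) = 0 \<and>
     (\<forall>lam\<ge>0. lasso_kkt X y lam (B lam))"

definition sigma_update :: "real^'p^'n \<Rightarrow> real^'n \<Rightarrow> real \<Rightarrow> real^'p \<Rightarrow> real" where
  "sigma_update X y a b = norm (y - X *v b) / sqrt ((1 - a) * real CARD('n))"

text \<open>
  \<open>b0\<close> is the starting value. Pass number \<open>k + 1\<close> of the algorithm turns the current coefficient
  vector \<open>beta_iter k\<close> into the noise level \<open>sigma_iter k\<close> and the vector \<open>beta_iter (Suc k)\<close>.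
\<close>

primrec beta_iter ::
    "real^'p^'n \<Rightarrow> real^'n \<Rightarrow> (real \<Rightarrow> real^'p) \<Rightarrow> real \<Rightarrow> real \<Rightarrow> real^'p \<Rightarrow> nat \<Rightarrow> real^'p" where
  "beta_iter X y B lam0 a b0 0 = b0"
| "beta_iter X y B lam0 a b0 (Suc k) =
     B (sigma_update X y a (beta_iter X y B lam0 a b0 k) * lam0)"

definition sigma_iter ::
    "real^'p^'n \<Rightarrow> real^'n \<Rightarrow> (real \<Rightarrow> real^'p) \<Rightarrow> real \<Rightarrow> real \<Rightarrow> real^'p \<Rightarrow> nat \<Rightarrow> real" where
  "sigma_iter X y B lam0 a b0 k = sigma_update X y a (beta_iter X y B lam0 a b0 k)"

definition beta_hat ::
    "real^'p^'n \<Rightarrow> real^'n \<Rightarrow> (real \<Rightarrow> real^'p) \<Rightarrow> real \<Rightarrow> real \<Rightarrow> real^'p \<Rightarrow> real^'p" where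
  "beta_hat X y B lam0 a b0 = lim (beta_iter X y B lam0 a b0)"

definition sigma_hat ::
    "real^'p^'n \<Rightarrow> real^'n \<Rightarrow> (real \<Rightarrow> real^'p) \<Rightarrow> real \<Rightarrow> real \<Rightarrow> real^'p \<Rightarrow> real" where
  "sigma_hat X y B lam0 a b0 = lim (sigma_iter X y B lam0 a b0)"

text \<open>
  The path for the response \<open>c *\<^sub>R y\<close> obtained by rescaling a path for \<open>y\<close>. For \<open>c = 0\<close> it is the
  zero path.
\<close>

definition rescaled_path :: "real \<Rightarrow> (real \<Rightarrow> real^'p) \<Rightarrow> real \<Rightarrow> real^'p" where
  "rescaled_path c B lam = c *\<^sub>R B (lam / \<bar>c\<bar>)"

end

theory Submission
  imports Defs
begin

text \<open>
  At a point of the path the KKT conditions say that the jointly convex loss has a supporting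
  hyperplane with no slope in the coefficient direction. Hence the loss along the path is the
  partial minimum over the coefficients, it is convex in the noise level, and its slope at \<open>s\<close> is a
  positive multiple of \<open>1 - (step s / s)\<^sup>2\<close>, where \<open>step\<close> is one pass of the algorithm in the noise
  level. Positive fixed points of \<open>step\<close> are therefore exactly the minimising noise levels. The
  residual norm increases with the penalty level, so \<open>step\<close> is monotone, bounded and continuous, and
  its iterates converge monotonically to a fixed point. If a minimiser exists, the limit is
  positive, hence minimising. Otherwise the noise levels decrease to \<open>0\<close>, and the supporting
  hyperplanes along the iteration still force the loss down to its infimum.
\<close>

subsection \<open>Convexity of the loss\<close>

text \<open>Expand |x - s v|^2 >= 0 and divide by \<open>s\<close>. For fixed \<open>v\<close> the
  left side is linear in \<open>(x, s)\<close> and equality holds at \<open>v = x / s\<close>, so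
  this is the tangent inequality of the quadratic-over-linear function.\<close>

lemma quad_over_linear_tangent:
  fixes x v :: "'a::real_inner"
  assumes "s > 0"
  shows "2 * (x \<bullet> v) - s * (norm v)\<^sup>2 \<le> (norm x)\<^sup>2 / s"
proof -
  have "0 \<le> (norm (x - s *\<^sub>R v))\<^sup>2"
    by simp
  also have "\<dots> = (norm x)\<^sup>2 - s * (2 * (x \<bullet> v) - s * (norm v)\<^sup>2)"
    by (simp add: power2_norm_eq_inner inner_diff_left inner_diff_right inner_commute algebra_simps)
  finally show ?thesis
    using assms by (simp add: field_simps)
qed

text \<open>One tangent, exact at the convex combination, bounds the function from below at both end
  points; its linearity gives the claim.\<close>

lemma convex_on_quad_over_linear:
  "convex_on (UNIV \<times> {0<..}) (\<lambda>(x :: 'a::real_inner, s). (norm x)\<^sup>2 / s)"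
proof (rule convex_onI)
  fix t :: real and p q :: "'a \<times> real"
  assume t: "0 < t" "t < 1" and "p \<in> UNIV \<times> {0<..}" "q \<in> UNIV \<times> {0<..}"
  then obtain x r z s where p: "p = (x, r)" "r > 0" and q: "q = (z, s)" "s > 0"
    by auto
  define m where "m = (1 - t) *\<^sub>R x + t *\<^sub>R z"
  define u where "u = (1 - t) * r + t * s"
  \<comment> \<open>This \<open>v\<close> makes the tangent exact at \<open>(m, u)\<close>.\<close>
  define v where "v = (1 / u) *\<^sub>R m"
  have u: "u > 0"
    unfolding u_def using t p q by (intro add_pos_pos mult_pos_pos) auto
  have "(norm m)\<^sup>2 / u = 2 * (m \<bullet> v) - u * (norm v)\<^sup>2"
    using u by (simp add: v_def power_divide flip: power2_norm_eq_inner) (simp add: power2_eq_square)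
  also have "\<dots> = (1 - t) * (2 * (x \<bullet> v) - r * (norm v)\<^sup>2) + t * (2 * (z \<bullet> v) - s * (norm v)\<^sup>2)"
    by (simp add: m_def u_def inner_add_left algebra_simps)
  also have "\<dots> \<le> (1 - t) * ((norm x)\<^sup>2 / r) + t * ((norm z)\<^sup>2 / s)"
    using t p q by (intro add_mono mult_left_mono quad_over_linear_tangent) auto
  finally show "(case (1 - t) *\<^sub>R p + t *\<^sub>R q of (x, s) \<Rightarrow> (norm x)\<^sup>2 / s)
      \<le> (1 - t) * (case p of (x, s) \<Rightarrow> (norm x)\<^sup>2 / s) + t * (case q of (x, s) \<Rightarrow> (norm x)\<^sup>2 / s)"
    by (simp add: p q m_def u_def)
qed (intro convex_Times convex_UNIV convex_real_interval)

lemma convex_on_l1norm: "convex_on UNIV l1norm"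
proof (rule convex_onI)
  fix t :: real and x z :: "real^'p"
  assume "0 < t" "t < 1"
  then have "\<bar>((1 - t) *\<^sub>R x + t *\<^sub>R z) $ j\<bar> \<le> (1 - t) * \<bar>x $ j\<bar> + t * \<bar>z $ j\<bar>" for j
    using abs_triangle_ineq[of "(1 - t) * x $ j" "t * z $ j"] by (simp add: abs_mult)
  then show "l1norm ((1 - t) *\<^sub>R x + t *\<^sub>R z) \<le> (1 - t) * l1norm x + t * l1norm z"
    by (simp add: l1norm_def sum_distrib_left flip: sum.distrib) (rule sum_mono, simp)
qed simp

text \<open>The residual is affine in \<open>b\<close>, so the first term is the
  quadratic-over-linear function after an affine map. The \<open>l1norm\<close> term is convex, and
  the remaining term is linear in \<open>s\<close>.\<close>

lemma convex_on_scaled_loss: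
  fixes X :: "real^'p^'n"
  assumes "lam0 \<ge> 0"
  shows "convex_on (UNIV \<times> {0<..}) (\<lambda>(b, s). scaled_loss X y lam0 a b s)"
proof (rule convex_onI)
  fix t :: real and p q :: "(real^'p) \<times> real"
  assume t: "0 < t" "t < 1" and "p \<in> UNIV \<times> {0<..}" "q \<in> UNIV \<times> {0<..}"
  then obtain b r d s where p: "p = (b, r)" "r > 0" and q: "q = (d, s)" "s > 0"
    by auto
  have res: "y - X *v ((1 - t) *\<^sub>R b + t *\<^sub>R d) = (1 - t) *\<^sub>R (y - X *v b) + t *\<^sub>R (y - X *v d)"
    by (simp add: matrix_vector_right_distrib matrix_vector_mult_scaleR algebra_simps)
  define w where "w = 1 / (2 * real CARD('n))"
  have loss: "scaled_loss X y lam0 a b s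
      = w * ((norm (y - X *v b))\<^sup>2 / s) + lam0 * l1norm b + (1 - a) / 2 * s" for b s
    by (simp add: scaled_loss_def w_def)
  have comb: "(1 - t) * (w * q + lam0 * l + e * r) + t * (w * q' + lam0 * l' + e * s)
      = w * ((1 - t) * q + t * q') + lam0 * ((1 - t) * l + t * l') + e * ((1 - t) * r + t * s)" for q q' l l' e
    by (simp add: algebra_simps)
  have quad: "(norm (y - X *v ((1 - t) *\<^sub>R b + t *\<^sub>R d)))\<^sup>2 / ((1 - t) * r + t * s)
      \<le> (1 - t) * ((norm (y - X *v b))\<^sup>2 / r) + t * ((norm (y - X *v d))\<^sup>2 / s)"
    using convex_onD[OF convex_on_quad_over_linear, of t "(y - X *v b, r)" "(y - X *v d, s)"] t p q
    by (simp add: res)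
  have l1: "l1norm ((1 - t) *\<^sub>R b + t *\<^sub>R d) \<le> (1 - t) * l1norm b + t * l1norm d"
    using convex_onD[OF convex_on_l1norm, of t b d] t by simp
  show "(case (1 - t) *\<^sub>R p + t *\<^sub>R q of (b, s) \<Rightarrow> scaled_loss X y lam0 a b s)
      \<le> (1 - t) * (case p of (b, s) \<Rightarrow> scaled_loss X y lam0 a b s)
        + t * (case q of (b, s) \<Rightarrow> scaled_loss X y lam0 a b s)"
    unfolding p q scaleR_Pair add_Pair prod.case real_scaleR_def loss comb
    using assms by (intro add_mono mult_left_mono quad l1 order_refl) (auto simp: w_def)
qed (intro convex_Times convex_UNIV convex_real_interval)

subsection \<open>Consequences of the KKT conditions\<close>

lemma inner_matrix_vector_mult:
  fixes X :: "real^'p^'n"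
  shows "r \<bullet> (X *v d) = (\<Sum>j\<in>UNIV. (column j X \<bullet> r) * d $ j)"
  by (simp add: matrix_mult_sum inner_sum_right scalar_mult_eq_scaleR inner_commute mult.commute)

text \<open>The KKT conditions say that X'(y - Xb)/n is \<open>lam\<close> times a subgradient of
  the l1 norm at \<open>b\<close>. The subgradient inequality is checked per coordinate and
  summed.\<close>

lemma lasso_kkt_subgradient:
  fixes X :: "real^'p^'n"
  assumes "lasso_kkt X y lam b" "lam \<ge> 0"
  shows "(y - X *v b) \<bullet> (X *v (b' - b)) \<le> real CARD('n) * lam * (l1norm b' - l1norm b)"
proof -
  define g where "g j = (column j X \<bullet> (y - X *v b)) / real CARD('n)" for j
  have "g j * (b' - b) $ j \<le> lam * (\<bar>b' $ j\<bar> - \<bar>b $ j\<bar>)" for j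
  proof (cases "b $ j = 0")
    case True
    then obtain t where t: "g j = lam * t" "\<bar>t\<bar> \<le> 1"
      using assms(1) unfolding lasso_kkt_def g_def by fastforce
    have "t * b' $ j \<le> \<bar>t\<bar> * \<bar>b' $ j\<bar>"
      by (metis abs_ge_self abs_mult)
    also have "\<dots> \<le> \<bar>b' $ j\<bar>"
      using t by (simp add: mult_left_le_one_le)
    finally show ?thesis
      using t True assms(2) by (simp add: mult.assoc mult_left_mono)
  next
    case False
    then have g: "g j = lam * sgn (b $ j)"
      using assms(1) unfolding lasso_kkt_def g_def by blast
    have "sgn (b $ j) * (b' - b) $ j \<le> \<bar>b' $ j\<bar> - \<bar>b $ j\<bar>"
      using False by (auto simp: sgn_if)
    then show ?thesis
      using g assms(2) by (simp add: mult.assoc mult_left_mono)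
  qed
  then have "(\<Sum>j\<in>UNIV. g j * (b' - b) $ j) \<le> (\<Sum>j\<in>UNIV. lam * (\<bar>b' $ j\<bar> - \<bar>b $ j\<bar>))"
    by (rule sum_mono)
  also have "\<dots> = lam * (l1norm b' - l1norm b)"
    by (simp add: l1norm_def sum_distrib_left sum_subtractf right_diff_distrib)
  finally have "(\<Sum>j\<in>UNIV. g j * (b' - b) $ j) \<le> lam * (l1norm b' - l1norm b)" .
  moreover have "(y - X *v b) \<bullet> (X *v (b' - b)) = real CARD('n) * (\<Sum>j\<in>UNIV. g j * (b' - b) $ j)"
    by (simp add: inner_matrix_vector_mult g_def sum_distrib_left)
  ultimately show ?thesis
    by (simp add: mult.assoc)
qed

text \<open>The subgradient inequality rewritten in terms of the two residuals, the form in which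
  different coefficient vectors are compared below.\<close>

lemma lasso_kkt_residual_inner:
  fixes X :: "real^'p^'n"
  assumes "lasso_kkt X y lam b" "lam \<ge> 0"
  shows "(norm (y - X *v b))\<^sup>2 - real CARD('n) * lam * (l1norm b' - l1norm b)
    \<le> (y - X *v b') \<bullet> (y - X *v b)"
proof -
  have "y - X *v b' = (y - X *v b) - X *v (b' - b)"
    by (simp add: matrix_vector_mult_diff_distrib)
  then have "(y - X *v b') \<bullet> (y - X *v b) = (norm (y - X *v b))\<^sup>2 - (y - X *v b) \<bullet> (X *v (b' - b))"
    by (simp only: inner_diff_left[of "y - X *v b"] power2_norm_eq_inner) (simp only: inner_commute)
  then show ?thesis
    using lasso_kkt_subgradient[OF assms, of b'] by simp
qed

text \<open>The quadratic part is bounded by its tangent with \<open>v\<close> equal to the residual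
  of \<open>b\<close> divided by \<open>s\<close>. At penalty level \<open>s * lam0\<close> the KKT
  bound carries a factor \<open>s\<close> that this division removes, so the l1 terms cancel and
  only a slope in the noise level remains.\<close>

lemma lasso_kkt_loss_tangent:
  fixes X :: "real^'p^'n"
  assumes kkt: "lasso_kkt X y (s * lam0) b" and "lam0 \<ge> 0" "s > 0" "s' > 0"
  shows "scaled_loss X y lam0 a b s
      + (s' - s) * ((1 - a) / 2 - (norm (y - X *v b))\<^sup>2 / (2 * real CARD('n) * s\<^sup>2))
    \<le> scaled_loss X y lam0 a b' s'"
proof -
  define n where "n = real CARD('n)"
  have n: "n > 0"
    by (simp add: n_def)
  define R where "R = (norm (y - X *v b))\<^sup>2"
  define I where "I = (y - X *v b') \<bullet> (y - X *v b)"
  define D where "D = l1norm b' - l1norm b"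
  have "2 * I / s - s' * R / s\<^sup>2 \<le> (norm (y - X *v b'))\<^sup>2 / s'"
    using quad_over_linear_tangent[OF \<open>s' > 0\<close>, of "y - X *v b'" "(1 / s) *\<^sub>R (y - X *v b)"] \<open>s > 0\<close>
    by (simp add: I_def R_def power_divide power_mult_distrib)
  moreover have "2 * (R / s - n * lam0 * D) \<le> 2 * I / s"
  proof -
    have "R - n * (s * lam0) * D \<le> I"
      using lasso_kkt_residual_inner[OF kkt, of b'] assms by (simp add: R_def I_def D_def n_def)
    then have "(R - n * (s * lam0) * D) / s \<le> I / s"
      using \<open>s > 0\<close> by (simp add: divide_right_mono)
    then show ?thesis
      using \<open>s > 0\<close> by (simp add: diff_divide_distrib)
  qed
  ultimately have "2 * R / s - s' * R / s\<^sup>2 - 2 * n * lam0 * D \<le> (norm (y - X *v b'))\<^sup>2 / s'"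
    by (simp add: algebra_simps)
  then have "(2 * R / s - s' * R / s\<^sup>2 - 2 * n * lam0 * D) / (2 * n) \<le> (norm (y - X *v b'))\<^sup>2 / s' / (2 * n)"
    using n by (intro divide_right_mono) auto
  moreover have "(2 * R / s - s' * R / s\<^sup>2 - 2 * n * lam0 * D) / (2 * n)
      = R / (2 * n * s) - (s' - s) * (R / (2 * n * s\<^sup>2)) - lam0 * D"
    using n \<open>s > 0\<close> by (simp add: field_simps power2_eq_square)
  ultimately show ?thesis
    unfolding scaled_loss_def n_def[symmetric] R_def[symmetric] D_def
    by (simp add: algebra_simps diff_divide_distrib)
qed

text \<open>If \<open>b'\<close> has the smaller l1 norm, the KKT conditions at \<open>lam\<close>
  alone give |r|^2 <= r'.r for the residuals, hence |r| <= |r'|. Otherwise the KKT inequalities at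
  both levels add up to |r - r'|^2 <= 0, and the residuals coincide.\<close>

lemma lasso_kkt_norm_residual_mono:
  fixes X :: "real^'p^'n"
  assumes kkt: "lasso_kkt X y lam b" "lasso_kkt X y lam' b'" and lam: "0 \<le> lam" "lam \<le> lam'"
  shows "norm (y - X *v b) \<le> norm (y - X *v b')"
proof (cases "l1norm b' \<le> l1norm b")
  case True
  have "2 * ((y - X *v b') \<bullet> (y - X *v b)) - (norm (y - X *v b))\<^sup>2 \<le> (norm (y - X *v b'))\<^sup>2"
    using quad_over_linear_tangent[of 1 "y - X *v b'" "y - X *v b"] by simp
  moreover have "real CARD('n) * lam * (l1norm b' - l1norm b) \<le> 0"
    using True lam by (intro mult_nonneg_nonpos) auto
  ultimately have "(norm (y - X *v b))\<^sup>2 \<le> (norm (y - X *v b'))\<^sup>2"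
    using lasso_kkt_residual_inner[OF kkt(1) lam(1), of b'] by linarith
  then show ?thesis
    using power2_le_imp_le norm_ge_zero by blast
next
  case False
  have "(norm ((y - X *v b) - (y - X *v b')))\<^sup>2
      = ((norm (y - X *v b))\<^sup>2 - (y - X *v b') \<bullet> (y - X *v b))
        + ((norm (y - X *v b'))\<^sup>2 - (y - X *v b) \<bullet> (y - X *v b'))"
    by (simp only: power2_norm_eq_inner inner_diff_left inner_diff_right)
  also have "\<dots> \<le> real CARD('n) * lam * (l1norm b' - l1norm b) + real CARD('n) * lam' * (l1norm b - l1norm b')"
    using lasso_kkt_residual_inner[OF kkt(1), of b'] lasso_kkt_residual_inner[OF kkt(2), of b] lam by linarith
  also have "\<dots> = real CARD('n) * ((lam - lam') * (l1norm b' - l1norm b))"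
    by (simp add: algebra_simps)
  also have "\<dots> \<le> 0"
    using False lam by (intro mult_nonneg_nonpos mult_nonpos_nonneg) auto
  finally show ?thesis
    by simp
qed

lemma lasso_kkt_norm_residual_unique:
  fixes X :: "real^'p^'n"
  assumes "lasso_kkt X y lam b" "lasso_kkt X y lam b'" "lam \<ge> 0"
  shows "norm (y - X *v b) = norm (y - X *v b')"
  using lasso_kkt_norm_residual_mono[of X y lam b lam b'] lasso_kkt_norm_residual_mono[of X y lam b' lam b]
    assms by simp

lemma l1norm_nonneg: "l1norm b \<ge> 0"
  by (simp add: l1norm_def sum_nonneg)

text \<open>Comparison with the zero vector, whose residual is \<open>y\<close>, followed by
  Cauchy-Schwarz. This bounds the iteration.\<close>

lemma lasso_kkt_norm_residual_le:
  fixes X :: "real^'p^'n"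
  assumes "lasso_kkt X y lam b" "lam \<ge> 0"
  shows "norm (y - X *v b) \<le> norm y"
proof -
  have "real CARD('n) * lam * (l1norm (0 :: real^'p) - l1norm b) \<le> 0"
    using assms l1norm_nonneg[of b] by (intro mult_nonneg_nonpos) (auto simp: l1norm_def)
  then have "(norm (y - X *v b))\<^sup>2 \<le> y \<bullet> (y - X *v b)"
    using lasso_kkt_residual_inner[OF assms, of 0]
    unfolding matrix_vector_mult_0_right diff_zero by linarith
  also have "\<dots> \<le> norm y * norm (y - X *v b)"
    by (rule norm_cauchy_schwarz)
  finally show ?thesis
    by (cases "y - X *v b = 0") (auto simp: power2_eq_square)
qed

text \<open>With a zero residual all correlations vanish, while a nonzero coordinate would force one
  of size \<open>lam\<close>. So \<open>b = 0\<close>, contradicting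
  \<open>y \<noteq> 0\<close>.\<close>

lemma lasso_kkt_residual_nonzero:
  fixes X :: "real^'p^'n"
  assumes kkt: "lasso_kkt X y lam b" and "lam > 0" "y \<noteq> 0"
  shows "X *v b \<noteq> y"
proof
  assume eq: "X *v b = y"
  have "b $ j = 0" for j
    using kkt \<open>lam > 0\<close> by (auto simp: lasso_kkt_def eq sgn_if split: if_splits)
  then have "b = 0"
    by (simp add: vec_eq_iff)
  then show False
    using eq \<open>y \<noteq> 0\<close> by simp
qed

subsection \<open>The iteration\<close>

text \<open>The tangents at \<open>s\<close> and \<open>v\<close> squeeze the difference quotient
  between \<open>D s\<close> and \<open>D v\<close>. This avoids differentiating the path, which may
  have kinks at its knots.\<close>

lemma has_real_derivative_tangent:
  fixes h D :: "real \<Rightarrow> real"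
  assumes S: "open S" "s \<in> S"
    and tangent: "\<And>u v. u \<in> S \<Longrightarrow> v \<in> S \<Longrightarrow> h u + (v - u) * D u \<le> h v"
    and cont: "isCont D s"
  shows "(h has_real_derivative D s) (at s)"
proof -
  have "\<forall>\<^sub>F v in at s. norm ((h v - h s) / (v - s) - D s) \<le> norm (D v - D s)"
    using eventually_at_in_open[OF S]
  proof eventually_elim
    case (elim v)
    then have v: "v \<in> S" "v \<noteq> s"
      by auto
    have le: "(v - s) * D s \<le> h v - h s" "h v - h s \<le> (v - s) * D v"
      using tangent[of s v] tangent[of v s] v S by (auto simp: algebra_simps)
    define q where "q = (h v - h s) / (v - s)"
    have q: "h v - h s = (v - s) * q"
      using v by (simp add: q_def)
    show ?case
    proof (cases "s < v")
      case True
      then have "D s \<le> q" "q \<le> D v"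
        using le unfolding q by auto
      then show ?thesis
        by (simp flip: q_def)
    next
      case False
      then have "D v \<le> q" "q \<le> D s"
        using le v unfolding q by auto
      then show ?thesis
        by (simp flip: q_def)
    qed
  qed
  moreover have "((\<lambda>v. norm (D v - D s)) \<longlongrightarrow> 0) (at s)"
    using cont by (intro tendsto_norm_zero LIM_zero) (simp add: isCont_def)
  ultimately have "((\<lambda>v. (h v - h s) / (v - s) - D s) \<longlongrightarrow> 0) (at s)"
    by (rule Lim_null_comparison)
  then show ?thesis
    by (simp add: has_field_derivative_iff LIM_zero_iff)
qed

text \<open>A monotone \<open>f\<close> propagates the order of the first two terms, so an orbit
  keeps the direction of its first move.\<close>

lemma iterate_mono_on_monotone:
  fixes u :: "nat \<Rightarrow> 'a::linorder"
  assumes rec: "\<And>k. u (Suc k) = f (u k)" and "mono_on S f" "\<And>k. u k \<in> S"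
  shows "u 0 \<le> u 1 \<Longrightarrow> incseq u" and "u 1 \<le> u 0 \<Longrightarrow> decseq u"
proof -
  show "incseq u" if "u 0 \<le> u 1"
  proof (rule incseq_SucI)
    show "u k \<le> u (Suc k)" for k
    proof (induction k)
      case (Suc k)
      then show ?case
        using mono_onD[OF assms(2,3,3)] by (metis rec)
    qed (use that in simp)
  qed
  show "decseq u" if "u 1 \<le> u 0"
  proof (rule decseq_SucI)
    show "u (Suc k) \<le> u k" for k
    proof (induction k)
      case (Suc k)
      then show ?case
        using mono_onD[OF assms(2,3,3)] by (metis rec)
    qed (use that in simp)
  qed
qed

lemma sigma_iter_Suc:
  "sigma_iter X y B lam0 a b0 (Suc k) = sigma_update X y a (B (sigma_iter X y B lam0 a b0 k * lam0))"
  by (simp add: sigma_iter_def)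

section \<open>The loss along the path and its derivative in the noise level\<close>

locale scaled_lasso =
  fixes X :: "real^'p^'n" and y :: "real^'n" and B :: "real \<Rightarrow> real^'p" and lam0 a :: real
  assumes lam0: "lam0 > 0" and path: "lasso_path X y B"
begin

definition profile :: "real \<Rightarrow> real" where
  "profile s = scaled_loss X y lam0 a (B (s * lam0)) s"

definition slope :: "real \<Rightarrow> real" where
  "slope s = (1 - a) / 2 - (norm (y - X *v B (s * lam0)))\<^sup>2 / (2 * real CARD('n) * s\<^sup>2)"

definition step :: "real \<Rightarrow> real" where
  "step s = sigma_update X y a (B (s * lam0))"

lemma kkt: "lam \<ge> 0 \<Longrightarrow> lasso_kkt X y lam (B lam)"
  using path by (simp add: lasso_path_def)

lemma continuous_on_path: "continuous_on {0..} B"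
  using path by (simp add: lasso_path_def linear_spline_on_def)

lemma continuous_on_path_scaled: "continuous_on {0..} (\<lambda>s. B (s * lam0))"
  by (rule continuous_on_compose2[OF continuous_on_path]) (use lam0 in \<open>auto intro!: continuous_intros\<close>)

lemma loss_tangent:
  assumes "s > 0" "s' > 0"
  shows "profile s + (s' - s) * slope s \<le> scaled_loss X y lam0 a b s'"
  unfolding profile_def slope_def
  by (rule lasso_kkt_loss_tangent) (use assms lam0 kkt in auto)

text \<open>An envelope argument: \<open>slope\<close> is a continuous choice of subgradients of
  \<open>profile\<close>, so the movement of the path contributes nothing to the derivative.\<close>

lemma profile_has_derivative:
  assumes "s > 0"
  shows "(profile has_real_derivative slope s) (at s)"
proof (rule has_real_derivative_tangent)
  show "profile u + (v - u) * slope u \<le> profile v" if "u \<in> {0<..}" "v \<in> {0<..}" for u v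
    using loss_tangent[of u v "B (v * lam0)"] that by (simp add: profile_def)
  have "continuous_on {0<..} (\<lambda>s. B (s * lam0))"
    using continuous_on_path_scaled by (rule continuous_on_subset) auto
  then have "continuous_on {0<..} slope"
    unfolding slope_def
    by (intro continuous_intros linear_continuous_on_compose[OF _ matrix_vector_mul_linear]) auto
  then show "isCont slope s"
    using assms by (simp add: continuous_on_eq_continuous_at)
qed (use assms in auto)

text \<open>Add the tangent inequalities at \<open>u\<close> and \<open>v\<close>.\<close>

lemma slope_mono:
  assumes "0 < u" "u \<le> v"
  shows "slope u \<le> slope v"
proof -
  have "(v - u) * slope u \<le> (v - u) * slope v"
    using loss_tangent[of u v "B (v * lam0)"] loss_tangent[of v u "B (u * lam0)"] assms
    by (simp add: profile_def algebra_simps)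
  then show ?thesis
    using \<open>u \<le> v\<close> by (cases "u = v") auto
qed

lemma sigma_iter_step: "sigma_iter X y B lam0 a b0 (Suc k) = step (sigma_iter X y B lam0 a b0 k)"
  by (simp add: sigma_iter_Suc step_def)

lemma beta_iter_Suc: "beta_iter X y B lam0 a b0 (Suc k) = B (sigma_iter X y B lam0 a b0 k * lam0)"
  by (simp add: sigma_iter_def)

section \<open>Noise-level iteration and its fixed points\<close>

context
  assumes a: "a < 1"
begin

lemma sigma_update_nonneg: "sigma_update X z a b \<ge> 0"
  using a by (simp add: sigma_update_def)

lemma sigma_iter_nonneg: "sigma_iter X y B lam0 a b0 k \<ge> 0"
  unfolding sigma_iter_def by (rule sigma_update_nonneg)

lemma step_mono: "mono_on {0..} step"
proof (rule mono_onI)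
  fix u v :: real
  assume "u \<in> {0..}" "v \<in> {0..}" "u \<le> v"
  then show "step u \<le> step v"
    unfolding step_def sigma_update_def
    by (intro divide_right_mono lasso_kkt_norm_residual_mono[OF kkt kkt]) (use a lam0 in auto)
qed

lemma continuous_on_step: "continuous_on {0..} step"
  unfolding step_def sigma_update_def
  by (intro continuous_intros linear_continuous_on_compose[OF _ matrix_vector_mul_linear]
      continuous_on_path_scaled) (use a in auto)

lemma step_le: "s \<ge> 0 \<Longrightarrow> step s \<le> norm y / sqrt ((1 - a) * real CARD('n))"
  unfolding step_def sigma_update_def
  by (intro divide_right_mono lasso_kkt_norm_residual_le[OF kkt]) (use a lam0 in auto)

lemma slope_eq_step: "s > 0 \<Longrightarrow> slope s = (1 - a) / 2 * (1 - (step s / s)\<^sup>2)"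
  using a by (simp add: slope_def step_def sigma_update_def power_divide field_simps)

lemma slope_nonneg_iff: "s > 0 \<Longrightarrow> slope s \<ge> 0 \<longleftrightarrow> step s \<le> s"
  using a sigma_update_nonneg
  by (simp add: slope_eq_step zero_le_mult_iff step_def power_le_one_iff)

lemma slope_eq_0_iff: "s > 0 \<Longrightarrow> slope s = 0 \<longleftrightarrow> step s = s"
proof -
  assume s: "s > 0"
  then have "step s / s \<ge> 0"
    using sigma_update_nonneg by (simp add: step_def)
  then show ?thesis
    using a s by (auto simp: slope_eq_step power2_eq_1_iff)
qed

lemma sigma_iter_incseq:
  "sigma_iter X y B lam0 a b0 0 \<le> sigma_iter X y B lam0 a b0 1 \<Longrightarrow> incseq (sigma_iter X y B lam0 a b0)"
  by (rule iterate_mono_on_monotone(1)[where f = step and S = "{0..}"])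
    (simp_all add: sigma_iter_step sigma_iter_nonneg step_mono)

lemma sigma_iter_decseq:
  "sigma_iter X y B lam0 a b0 1 \<le> sigma_iter X y B lam0 a b0 0 \<Longrightarrow> decseq (sigma_iter X y B lam0 a b0)"
  by (rule iterate_mono_on_monotone(2)[where f = step and S = "{0..}"])
    (simp_all add: sigma_iter_step sigma_iter_nonneg step_mono)

text \<open>A bounded monotone sequence converges, and continuity of \<open>step\<close> makes the
  limit a fixed point. The limit may be 0, so continuity is used on the closed half-line.\<close>

lemma iter_converges:
  obtains s where "s \<ge> 0" "step s = s"
    "sigma_iter X y B lam0 a b0 \<longlonglongrightarrow> s" "beta_iter X y B lam0 a b0 \<longlonglongrightarrow> B (s * lam0)"
proof -
  let ?u = "sigma_iter X y B lam0 a b0"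
  have "incseq ?u \<or> decseq ?u"
    using sigma_iter_incseq sigma_iter_decseq linorder_linear by blast
  then have "monoseq ?u"
    by (simp add: monoseq_iff)
  moreover have "Bseq ?u"
  proof (rule BseqI')
    \<comment> \<open>The initial noise level comes from the arbitrary \<open>b0\<close> and may
      exceed the bound on values of \<open>step\<close>, hence the maximum.\<close>
    show "norm (?u k) \<le> max (?u 0) (norm y / sqrt ((1 - a) * real CARD('n)))" for k
    proof (cases k)
      case (Suc j)
      then have "?u k \<le> norm y / sqrt ((1 - a) * real CARD('n))"
        using step_le[OF sigma_iter_nonneg] by (simp only: sigma_iter_step)
      then show ?thesis
        using sigma_iter_nonneg by simp
    qed (use sigma_iter_nonneg in simp)
  qed
  ultimately obtain s where lim: "?u \<longlonglongrightarrow> s"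
    using Bseq_monoseq_convergent convergentD by blast
  have s: "s \<ge> 0"
    using LIMSEQ_le_const[OF lim] sigma_iter_nonneg by blast
  have "(\<lambda>k. step (?u k)) \<longlonglongrightarrow> step s"
    by (rule continuous_on_tendsto_compose[OF continuous_on_step lim])
      (use s sigma_iter_nonneg in auto)
  then have "step s = s"
    using LIMSEQ_Suc[OF lim] LIMSEQ_unique by (auto simp: sigma_iter_step)
  moreover have "(\<lambda>k. B (?u k * lam0)) \<longlonglongrightarrow> B (s * lam0)"
    by (rule continuous_on_tendsto_compose[OF continuous_on_path_scaled lim])
      (use s sigma_iter_nonneg in auto)
  \<comment> \<open>The coefficients lag one index behind the noise levels, so the sequence is
    shifted before passing to the limit.\<close>
  then have "beta_iter X y B lam0 a b0 \<longlonglongrightarrow> B (s * lam0)"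
    by (subst filterlim_sequentially_Suc[symmetric]) (simp only: beta_iter_Suc)
  ultimately show ?thesis
    using that s lim by blast
qed

text \<open>At a positive fixed point the supporting hyperplane is horizontal.\<close>

lemma fixed_point_in_argmin:
  assumes "s > 0" "step s = s"
  shows "(B (s * lam0), s) \<in> scaled_argmin X y lam0 a"
  using loss_tangent[OF \<open>s > 0\<close>] assms slope_eq_0_iff[OF \<open>s > 0\<close>]
  by (auto simp: scaled_argmin_def is_arg_min_linorder profile_def)

text \<open>The vector \<open>b\<close> need not lie on the path, but replacing it by the path value
  does not raise the loss. Hence \<open>s\<close> minimises \<open>profile\<close> and the slope
  vanishes there.\<close>

lemma argmin_fixed_point:
  assumes "(b, s) \<in> scaled_argmin X y lam0 a"
  shows "s > 0" "step s = s"
proof -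
  show s: "s > 0"
    using assms by (simp add: scaled_argmin_def is_arg_min_linorder)
  have min: "scaled_loss X y lam0 a b s \<le> profile t" if "t > 0" for t
    using assms that by (simp add: scaled_argmin_def is_arg_min_linorder profile_def)
  have "slope s = 0"
  \<comment> \<open>Radius \<open>s\<close> keeps the neighbourhood inside the positive
    reals.\<close>
  proof (rule DERIV_local_min[OF profile_has_derivative[OF s] s], safe)
    fix t assume "\<bar>s - t\<bar> < s"
    then have "t > 0"
      by (simp add: abs_less_iff)
    then show "profile s \<le> profile t"
      using min[of t] loss_tangent[OF s s, of b] by auto
  qed
  then show "step s = s"
    using slope_eq_0_iff[OF s] by simp
qed

text \<open>A minimising noise level \<open>t\<close> is a barrier. A start above \<open>t\<close>
  stays above it by monotonicity of \<open>step\<close>; a start below \<open>t\<close> moves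
  upwards from a positive value.\<close>

lemma sigma_iter_limit_pos:
  assumes b0: "X *v b0 \<noteq> y" and ne: "scaled_argmin X y lam0 a \<noteq> {}"
    and lim: "sigma_iter X y B lam0 a b0 \<longlonglongrightarrow> s"
  shows "s > 0"
proof -
  let ?u = "sigma_iter X y B lam0 a b0"
  obtain b t where "(b, t) \<in> scaled_argmin X y lam0 a"
    using ne by auto
  note t = argmin_fixed_point[OF this]
  have u0: "?u 0 > 0"
    using b0 a by (simp add: sigma_iter_def sigma_update_def)
  show ?thesis
  proof (cases "t \<le> ?u 0")
    case True
    have "t \<le> ?u k" for k
    proof (induction k)
      case (Suc k)
      then show ?case
        using mono_onD[OF step_mono, of t "?u k"] t by (simp add: sigma_iter_step)
    qed (use True in simp)
    then show ?thesis
      using LIMSEQ_le_const[OF lim] t by (meson less_le_trans)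
  next
    case False
    then have "slope (?u 0) \<le> 0"
      using slope_mono[of "?u 0" t] slope_eq_0_iff[OF t(1)] t u0 by auto
    \<comment> \<open>A strict first descent would make the slope nonnegative, hence zero, and
      \<open>?u 0\<close> would be a fixed point after all.\<close>
    then have "?u 0 \<le> ?u 1"
      using slope_nonneg_iff[OF u0] slope_eq_0_iff[OF u0] by (auto simp: sigma_iter_step)
    then have "incseq ?u"
      by (rule sigma_iter_incseq)
    then show ?thesis
      using incseq_le[OF _ lim, of 0] u0 by linarith
  qed
qed

lemma iter_tendsto_hat:
  "beta_iter X y B lam0 a b0 \<longlonglongrightarrow> beta_hat X y B lam0 a b0"
  "sigma_iter X y B lam0 a b0 \<longlonglongrightarrow> sigma_hat X y B lam0 a b0"
  using iter_converges[of b0] by (metis beta_hat_def limI) (metis iter_converges sigma_hat_def limI)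

lemma hat_in_argmin:
  assumes "X *v b0 \<noteq> y" "scaled_argmin X y lam0 a \<noteq> {}"
  shows "(beta_hat X y B lam0 a b0, sigma_hat X y B lam0 a b0) \<in> scaled_argmin X y lam0 a"
proof -
  obtain s where s: "step s = s" "sigma_iter X y B lam0 a b0 \<longlonglongrightarrow> s"
    "beta_iter X y B lam0 a b0 \<longlonglongrightarrow> B (s * lam0)"
    using iter_converges .
  then show ?thesis
    using fixed_point_in_argmin sigma_iter_limit_pos[OF assms s(2)]
    by (simp add: beta_hat_def sigma_hat_def limI)
qed

lemma sigma_iter_pos:
  assumes "X *v b0 \<noteq> y" "y \<noteq> 0"
  shows "sigma_iter X y B lam0 a b0 k > 0"
proof (induction k)
  case 0
  then show ?case
    using assms a by (simp add: sigma_iter_def sigma_update_def)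
next
  case (Suc k)
  then have "X *v B (sigma_iter X y B lam0 a b0 k * lam0) \<noteq> y"
    by (intro lasso_kkt_residual_nonzero[OF kkt]) (use lam0 assms in auto)
  then show ?case
    using a by (simp add: sigma_iter_step step_def sigma_update_def)
qed

section \<open>Convergence of the loss to its infimum\<close>

lemma scaled_loss_nonneg: "s > 0 \<Longrightarrow> scaled_loss X y lam0 a b s \<ge> 0"
  using a lam0 l1norm_nonneg[of b] by (simp add: scaled_loss_def)

text \<open>Pairing index \<open>Suc k\<close> with \<open>k\<close> puts the pair on the path, so
  its loss is a value of \<open>profile\<close>. A positive limit of the noise levels attains the
  infimum. If the limit is 0, every competitor's noise level is eventually exceeded by none of the
  later iterates, and the tangents there bound its loss from below.\<close>

lemma loss_tendsto_inf:
  assumes "X *v b0 \<noteq> y" "y \<noteq> 0"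
  shows "(\<lambda>k. scaled_loss X y lam0 a (beta_iter X y B lam0 a b0 (Suc k)) (sigma_iter X y B lam0 a b0 k))
    \<longlonglongrightarrow> (INF (b, s) \<in> UNIV \<times> {0<..}. scaled_loss X y lam0 a b s)"
proof -
  let ?u = "sigma_iter X y B lam0 a b0"
  let ?L = "\<lambda>(b, s). scaled_loss X y lam0 a b s"
  let ?inf = "INF p \<in> UNIV \<times> {0<..}. ?L p"
  have bdd: "bdd_below (?L ` (UNIV \<times> {0<..}))"
    by (rule bdd_belowI[of _ 0]) (auto intro: scaled_loss_nonneg)
  have u: "?u k > 0" for k
    by (rule sigma_iter_pos[OF assms])
  obtain s where s: "s \<ge> 0" "step s = s" "?u \<longlonglongrightarrow> s"
    using iter_converges .
  have "(\<lambda>k. profile (?u k)) \<longlonglongrightarrow> ?inf"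
  proof (cases "s = 0")
    case False
    then have "(B (s * lam0), s) \<in> scaled_argmin X y lam0 a"
      using s by (intro fixed_point_in_argmin) auto
    then have "?inf = profile s"
      by (intro cInf_eq_minimum)
        (auto simp: scaled_argmin_def is_arg_min_linorder profile_def intro!: image_eqI[of _ _ "(B (s * lam0), s)"])
    moreover have "isCont profile s"
      using profile_has_derivative[of s] False s by (simp add: DERIV_isCont)
    ultimately show ?thesis
      using s isCont_tendsto_compose by metis
  next
    case True
    \<comment> \<open>An increasing sequence with a positive start cannot tend to 0.\<close>
    have "\<not> ?u 0 \<le> ?u 1"
    proof
      assume "?u 0 \<le> ?u 1"
      then have "incseq ?u"
        by (rule sigma_iter_incseq)
      then show False
        using incseq_le[OF _ s(3), of 0] u[of 0] True by linarith
    qed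
    then have dec: "decseq ?u"
      by (intro sigma_iter_decseq) simp
    \<comment> \<open>Descent at \<open>?u k\<close> means a nonnegative slope, so the tangent there
      bounds the loss at all larger noise levels.\<close>
    have below: "profile (?u k) \<le> scaled_loss X y lam0 a b t" if "?u k \<le> t" for k b t
    proof -
      have "slope (?u k) \<ge> 0"
        using decseq_SucD[OF dec, of k] slope_nonneg_iff[OF u] by (simp add: sigma_iter_step)
      then have "0 \<le> (t - ?u k) * slope (?u k)"
        using that by simp
      then show ?thesis
        using loss_tangent[OF u, of t k b] that u[of k] by linarith
    qed
    show ?thesis
    proof (rule order_tendstoI)
      fix e assume "e < ?inf"
      moreover have "?inf \<le> profile (?u k)" for k
        unfolding profile_def using cINF_lower[OF bdd, of "(B (?u k * lam0), ?u k)"] u by simp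
      ultimately show "\<forall>\<^sub>F k in sequentially. e < profile (?u k)"
        by (intro always_eventually allI) (rule less_le_trans)
    next
      fix e assume "?inf < e"
      then obtain b t where t: "t > 0" "scaled_loss X y lam0 a b t < e"
        by (subst (asm) cINF_less_iff[OF _ bdd]) auto
      have "\<forall>\<^sub>F k in sequentially. ?u k < t"
        using order_tendstoD(2)[OF s(3)] True t by simp
      then show "\<forall>\<^sub>F k in sequentially. profile (?u k) < e"
        by eventually_elim (use below t in \<open>meson less_imp_le le_less_trans\<close>)
    qed
  qed
  then show ?thesis
    by (simp only: profile_def beta_iter_Suc)
qed

end

end

subsection \<open>Scale equivariance\<close>

lemma l1norm_scaleR: "l1norm (c *\<^sub>R b) = \<bar>c\<bar> * l1norm b"
  by (simp add: l1norm_def abs_mult sum_distrib_left)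

lemma residual_scaleR:
  fixes X :: "real^'p^'n"
  shows "c *\<^sub>R y - X *v (c *\<^sub>R b) = c *\<^sub>R (y - X *v b)"
  by (simp add: matrix_vector_mult_scaleR scaleR_diff_right)

text \<open>The loss is positively homogeneous of degree one: the quadratic term gains c^2/|c| =
  |c|. For \<open>c = 0\<close> both sides are 0.\<close>

lemma scaled_loss_scaleR:
  "scaled_loss X (c *\<^sub>R y) lam0 a (c *\<^sub>R b) (\<bar>c\<bar> * s) = \<bar>c\<bar> * scaled_loss X y lam0 a b s"
proof (cases "c = 0")
  case False
  have "(\<bar>c\<bar> * r)\<^sup>2 / (m * (\<bar>c\<bar> * s)) = \<bar>c\<bar> * (r\<^sup>2 / (m * s))" for r m
    using False by (simp add: power2_eq_square)
  then show ?thesis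
    by (simp add: scaled_loss_def residual_scaleR l1norm_scaleR distrib_left)
qed (simp add: scaled_loss_def l1norm_def)

lemma scaled_argmin_scaleR_mem:
  assumes "c \<noteq> 0" "(b, s) \<in> scaled_argmin X y lam0 a"
  shows "(c *\<^sub>R b, \<bar>c\<bar> * s) \<in> scaled_argmin X (c *\<^sub>R y) lam0 a"
proof -
  have "\<bar>c\<bar> * scaled_loss X y lam0 a b s \<le> scaled_loss X (c *\<^sub>R y) lam0 a d t" if "t > 0" for d t
  proof -
    have "scaled_loss X y lam0 a b s \<le> scaled_loss X y lam0 a ((1 / c) *\<^sub>R d) (t / \<bar>c\<bar>)"
      using assms that by (auto simp: scaled_argmin_def is_arg_min_linorder)
    then have "\<bar>c\<bar> * scaled_loss X y lam0 a b s \<le> \<bar>c\<bar> * scaled_loss X y lam0 a ((1 / c) *\<^sub>R d) (t / \<bar>c\<bar>)"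
      by (rule mult_left_mono) simp
    also have "\<dots> = scaled_loss X (c *\<^sub>R y) lam0 a d t"
      using assms by (simp flip: scaled_loss_scaleR)
    finally show ?thesis .
  qed
  then show ?thesis
    using assms by (auto simp: scaled_argmin_def is_arg_min_linorder scaled_loss_scaleR)
qed

lemma scaled_argmin_scaleR:
  assumes "c \<noteq> 0"
  shows "scaled_argmin X (c *\<^sub>R y) lam0 a = (\<lambda>(b, s). (c *\<^sub>R b, \<bar>c\<bar> * s)) ` scaled_argmin X y lam0 a"
proof (intro equalityI subsetI)
  fix m assume "m \<in> scaled_argmin X (c *\<^sub>R y) lam0 a"
  then obtain b s where m: "m = (b, s)" "(b, s) \<in> scaled_argmin X (c *\<^sub>R y) lam0 a"
    by (cases m) auto
  \<comment> \<open>The reverse inclusion is the membership lemma applied to the inverse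
    scaling.\<close>
  then have "((1 / c) *\<^sub>R b, s / \<bar>c\<bar>) \<in> scaled_argmin X y lam0 a"
    using scaled_argmin_scaleR_mem[of "1 / c" b s X "c *\<^sub>R y"] assms by simp
  then show "m \<in> (\<lambda>(b, s). (c *\<^sub>R b, \<bar>c\<bar> * s)) ` scaled_argmin X y lam0 a"
    using assms m by (intro image_eqI) auto
qed (use assms scaled_argmin_scaleR_mem in auto)

section \<open>Rescaled solution paths and the iteration along them\<close>

lemma linear_spline_on_rescale:
  assumes "linear_spline_on {0..} f" "c \<noteq> 0"
  shows "linear_spline_on {0..} (\<lambda>t. c *\<^sub>R f (t / \<bar>c\<bar>))"
proof -
  obtain K where cont: "continuous_on {0..} f" and "finite K"
    and K: "\<And>u v. u \<le> v \<Longrightarrow> {u..v} \<subseteq> {0..} \<Longrightarrow> {u<..<v} \<inter> K = {} \<Longrightarrow>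
      \<exists>A D. \<forall>t\<in>{u..v}. f t = A + t *\<^sub>R D"
    using assms(1) unfolding linear_spline_on_def by metis
  \<comment> \<open>The knots move with the argument, from \<open>K\<close> to its multiples by
    |c|.\<close>
  have "\<exists>A D. \<forall>t\<in>{u..v}. c *\<^sub>R f (t / \<bar>c\<bar>) = A + t *\<^sub>R D"
    if uv: "u \<le> v" "{u..v} \<subseteq> {0..}" "{u<..<v} \<inter> (*) \<bar>c\<bar> ` K = {}" for u v
  proof -
    have "{u / \<bar>c\<bar><..<v / \<bar>c\<bar>} \<inter> K = {}"
      using uv(3) assms(2) by (auto simp: field_simps)
    moreover have "u \<ge> 0"
      using uv by auto
    then have "{u / \<bar>c\<bar>..v / \<bar>c\<bar>} \<subseteq> {0..}"
      by (auto intro: order_trans[rotated])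
    moreover have "u / \<bar>c\<bar> \<le> v / \<bar>c\<bar>"
      using uv(1) by (simp add: divide_right_mono)
    ultimately obtain A D where AD: "\<And>t. t \<in> {u / \<bar>c\<bar>..v / \<bar>c\<bar>} \<Longrightarrow> f t = A + t *\<^sub>R D"
      using K by metis
    have "c *\<^sub>R f (t / \<bar>c\<bar>) = c *\<^sub>R A + t *\<^sub>R ((c / \<bar>c\<bar>) *\<^sub>R D)" if "t \<in> {u..v}" for t
      using AD[of "t / \<bar>c\<bar>"] that by (simp add: divide_right_mono scaleR_add_right mult.commute)
    then show ?thesis
      by blast
  qed
  moreover have "continuous_on {0..} (\<lambda>t. c *\<^sub>R f (t / \<bar>c\<bar>))"
    by (intro continuous_intros continuous_on_compose2[OF cont]) (use assms in auto)
  ultimately show ?thesis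
    unfolding linear_spline_on_def using \<open>finite K\<close>
    by (intro conjI exI[of _ "(*) \<bar>c\<bar> ` K"] finite_imageI allI impI) simp_all
qed

lemma lasso_kkt_scaleR:
  fixes X :: "real^'p^'n"
  assumes kkt: "lasso_kkt X y (lam / \<bar>c\<bar>) b" and "c \<noteq> 0"
  shows "lasso_kkt X (c *\<^sub>R y) lam (c *\<^sub>R b)"
proof -
  have inner: "(column j X \<bullet> (c *\<^sub>R y - X *v (c *\<^sub>R b))) / real CARD('n)
      = c * ((column j X \<bullet> (y - X *v b)) / real CARD('n))" for j
    by (simp add: residual_scaleR)
  \<comment> \<open>Only the sign of \<open>c\<close> survives. It merges into the sign of the
    scaled coordinate, or maps [-1,1] into itself.\<close>
  have scale: "c * ((lam / \<bar>c\<bar>) * t) = lam * (sgn c * t)" for t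
    using \<open>c \<noteq> 0\<close> by (auto simp: sgn_if abs_if)
  show ?thesis
    unfolding lasso_kkt_def inner
  proof (intro allI conjI impI)
    fix j
    show "c * ((column j X \<bullet> (y - X *v b)) / real CARD('n)) = lam * sgn ((c *\<^sub>R b) $ j)"
      if "(c *\<^sub>R b) $ j \<noteq> 0"
    proof -
      have "(column j X \<bullet> (y - X *v b)) / real CARD('n) = (lam / \<bar>c\<bar>) * sgn (b $ j)"
        using kkt that unfolding lasso_kkt_def by simp
      then show ?thesis
        by (simp only: scale) (simp add: sgn_mult)
    qed
    show "c * ((column j X \<bullet> (y - X *v b)) / real CARD('n)) \<in> (*) lam ` {- 1..1}"
      if "(c *\<^sub>R b) $ j = 0"
    proof -
      have "b $ j = 0"
        using that \<open>c \<noteq> 0\<close> by simp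
      then have "(column j X \<bullet> (y - X *v b)) / real CARD('n) \<in> (\<lambda>t. (lam / \<bar>c\<bar>) * t) ` {-1..1}"
        using kkt unfolding lasso_kkt_def by blast
      then obtain t where "t \<in> {-1..1}" "(column j X \<bullet> (y - X *v b)) / real CARD('n) = (lam / \<bar>c\<bar>) * t"
        by (rule imageE)
      moreover from this have "sgn c * t \<in> {-1..1}"
        by (auto simp: sgn_if)
      ultimately show ?thesis
        by (simp only: scale) blast
    qed
  qed
qed

lemma lasso_path_rescaled:
  fixes X :: "real^'p^'n"
  assumes "lasso_path X y B"
  shows "lasso_path X (c *\<^sub>R y) (rescaled_path c B)"
proof (cases "c = 0")
  case True
  have "linear_spline_on {0..} (\<lambda>_. 0 :: real^'p)"
    unfolding linear_spline_on_def
    by (intro conjI exI[of _ "{}"] allI impI exI[of _ 0]) auto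
  moreover have "rescaled_path c B = (\<lambda>_. 0)"
    using True by (simp add: rescaled_path_def fun_eq_iff)
  ultimately show ?thesis
    using True by (auto simp: lasso_path_def lasso_kkt_def intro!: image_eqI[of _ _ 0])
next
  case False
  have "linear_spline_on {0..} (rescaled_path c B)"
    using linear_spline_on_rescale[of B c] assms False by (simp add: lasso_path_def rescaled_path_def[abs_def])
  moreover have "lasso_kkt X (c *\<^sub>R y) lam (rescaled_path c B lam)" if "lam \<ge> 0" for lam
    unfolding rescaled_path_def by (rule lasso_kkt_scaleR) (use assms False that in \<open>auto simp: lasso_path_def\<close>)
  \<comment> \<open>The starting level scales by |c|, so the division in
    \<open>rescaled_path\<close> returns to the level where \<open>B\<close> vanishes.\<close>
  moreover have "infnorm ((1 / real CARD('n)) *\<^sub>R (transpose X *v (c *\<^sub>R y)))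
      = \<bar>c\<bar> * infnorm ((1 / real CARD('n)) *\<^sub>R (transpose X *v y))"
    by (simp add: matrix_vector_mult_scaleR infnorm_mul)
  ultimately show ?thesis
    using assms False by (simp add: lasso_path_def rescaled_path_def)
qed

lemma sigma_update_scaleR: "sigma_update X (c *\<^sub>R y) a (c *\<^sub>R b) = \<bar>c\<bar> * sigma_update X y a b"
  by (simp add: sigma_update_def residual_scaleR)

lemma beta_iter_rescaled:
  "beta_iter X (c *\<^sub>R y) (rescaled_path c B) lam0 a (c *\<^sub>R b0) k = c *\<^sub>R beta_iter X y B lam0 a b0 k"
  by (induction k) (simp_all add: rescaled_path_def sigma_update_scaleR)

text \<open>KKT solutions at one level may differ, but an update sees only the residual norm, which
  the level determines.\<close>

lemma sigma_iter_path_unique: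
  fixes X :: "real^'p^'n"
  assumes "lasso_path X y B" "lasso_path X y B'" "lam0 \<ge> 0" "a < 1"
  shows "sigma_iter X y B lam0 a b0 k = sigma_iter X y B' lam0 a b0 k"
proof (induction k)
  case (Suc k)
  have "sigma_iter X y B' lam0 a b0 k * lam0 \<ge> 0"
    using assms by (simp add: sigma_iter_def sigma_update_def)
  then have "norm (y - X *v B (sigma_iter X y B' lam0 a b0 k * lam0))
      = norm (y - X *v B' (sigma_iter X y B' lam0 a b0 k * lam0))"
    using assms by (intro lasso_kkt_norm_residual_unique) (auto simp: lasso_path_def)
  then show ?case
    using Suc by (simp only: sigma_iter_Suc sigma_update_def)
qed (simp add: sigma_iter_def)

text \<open>The argmin can be empty: for \<open>y = 0\<close> and \<open>a < 1\<close> the loss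
  approaches its infimum only as the noise level tends to 0. Hence the separate claim about the
  infimum. Since KKT solutions may be non-unique, equivariance of the coefficients refers to the
  rescaled path, or to arbitrary paths and admissible starts when the minimiser is unique.\<close>

theorem proposition1:
  fixes X :: "real^'p^'n" and y :: "real^'n"
    and bhat :: "real \<Rightarrow> real^'p" and lam0 a :: real
  assumes "lam0 > 0" and "a \<ge> 0" and "lasso_path X y bhat"
  shows
    "convex_on (UNIV \<times> {0<..}) (\<lambda>(b, s). scaled_loss X y lam0 a b s) \<and>
    (a < 1 \<longrightarrow>
      (\<forall>b0. beta_iter X y bhat lam0 a b0 \<longlonglongrightarrow> beta_hat X y bhat lam0 a b0 \<and>
            sigma_iter X y bhat lam0 a b0 \<longlonglongrightarrow> sigma_hat X y bhat lam0 a b0) \<and>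
      (\<forall>b0. X *v b0 \<noteq> y \<longrightarrow> scaled_argmin X y lam0 a \<noteq> {} \<longrightarrow>
            (beta_hat X y bhat lam0 a b0, sigma_hat X y bhat lam0 a b0)
              \<in> scaled_argmin X y lam0 a) \<and>
      (\<forall>b0. X *v b0 \<noteq> y \<longrightarrow> y \<noteq> 0 \<longrightarrow>
            (\<forall>k. sigma_iter X y bhat lam0 a b0 k > 0) \<and>
            (\<lambda>k. scaled_loss X y lam0 a (beta_iter X y bhat lam0 a b0 (Suc k))
                                         (sigma_iter X y bhat lam0 a b0 k))
              \<longlonglongrightarrow> (INF (b, s) \<in> UNIV \<times> {0<..}. scaled_loss X y lam0 a b s))) \<and>
    (\<forall>c. c \<noteq> 0 \<longrightarrow>
      scaled_argmin X (c *\<^sub>R y) lam0 a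
        = (\<lambda>(b, s). (c *\<^sub>R b, \<bar>c\<bar> * s)) ` scaled_argmin X y lam0 a) \<and>
    (a < 1 \<longrightarrow>
      (\<forall>c b0. lasso_path X (c *\<^sub>R y) (rescaled_path c bhat) \<and>
        beta_hat X (c *\<^sub>R y) (rescaled_path c bhat) lam0 a (c *\<^sub>R b0)
          = c *\<^sub>R beta_hat X y bhat lam0 a b0) \<and>
      (\<forall>c b0 B. lasso_path X (c *\<^sub>R y) B \<longrightarrow>
        sigma_hat X (c *\<^sub>R y) B lam0 a (c *\<^sub>R b0) = \<bar>c\<bar> * sigma_hat X y bhat lam0 a b0) \<and>
      ((\<exists>!m. m \<in> scaled_argmin X y lam0 a) \<longrightarrow>
        (\<forall>c b0 b1 B. c \<noteq> 0 \<longrightarrow> lasso_path X (c *\<^sub>R y) B \<longrightarrow> X *v b0 \<noteq> y \<longrightarrow> X *v b1 \<noteq> c *\<^sub>R y \<longrightarrow>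
          beta_hat X (c *\<^sub>R y) B lam0 a b1 = c *\<^sub>R beta_hat X y bhat lam0 a b0 \<and>
          sigma_hat X (c *\<^sub>R y) B lam0 a b1 = \<bar>c\<bar> * sigma_hat X y bhat lam0 a b0))) \<and>
    (\<forall>s>0. ((\<lambda>t. scaled_loss X y lam0 a (bhat (t * lam0)) t) has_real_derivative
            (1 - a) / 2 - (norm (y - X *v bhat (s * lam0)))\<^sup>2 / (2 * real CARD('n) * s\<^sup>2)) (at s))"
proof (intro conjI impI allI)
  interpret scaled_lasso X y bhat lam0 a
    by unfold_locales (use assms in auto)
  show "convex_on (UNIV \<times> {0<..}) (\<lambda>(b, s). scaled_loss X y lam0 a b s)"
    using convex_on_scaled_loss assms(1) by (metis less_imp_le)
  show "scaled_argmin X (c *\<^sub>R y) lam0 a = (\<lambda>(b, s). (c *\<^sub>R b, \<bar>c\<bar> * s)) ` scaled_argmin X y lam0 a"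
    if "c \<noteq> 0" for c
    using scaled_argmin_scaleR that .
  show "((\<lambda>t. scaled_loss X y lam0 a (bhat (t * lam0)) t) has_real_derivative
      (1 - a) / 2 - (norm (y - X *v bhat (s * lam0)))\<^sup>2 / (2 * real CARD('n) * s\<^sup>2)) (at s)"
    if "s > 0" for s
    using profile_has_derivative[OF that] by (simp add: profile_def[abs_def] slope_def)
  assume a: "a < 1"
  show "beta_iter X y bhat lam0 a b0 \<longlonglongrightarrow> beta_hat X y bhat lam0 a b0"
    "sigma_iter X y bhat lam0 a b0 \<longlonglongrightarrow> sigma_hat X y bhat lam0 a b0" for b0
    using iter_tendsto_hat[OF a] by auto
  show "(beta_hat X y bhat lam0 a b0, sigma_hat X y bhat lam0 a b0) \<in> scaled_argmin X y lam0 a"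
    if "X *v b0 \<noteq> y" "scaled_argmin X y lam0 a \<noteq> {}" for b0
    using hat_in_argmin[OF a that] .
  show "sigma_iter X y bhat lam0 a b0 k > 0" if "X *v b0 \<noteq> y" "y \<noteq> 0" for b0 k
    using sigma_iter_pos[OF a that] .
  show "(\<lambda>k. scaled_loss X y lam0 a (beta_iter X y bhat lam0 a b0 (Suc k)) (sigma_iter X y bhat lam0 a b0 k))
      \<longlonglongrightarrow> (INF (b, s) \<in> UNIV \<times> {0<..}. scaled_loss X y lam0 a b s)"
    if "X *v b0 \<noteq> y" "y \<noteq> 0" for b0
    using loss_tendsto_inf[OF a that] .
  show resc: "lasso_path X (c *\<^sub>R y) (rescaled_path c bhat)" for c
    using lasso_path_rescaled assms(3) .
  show "beta_hat X (c *\<^sub>R y) (rescaled_path c bhat) lam0 a (c *\<^sub>R b0)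
      = c *\<^sub>R beta_hat X y bhat lam0 a b0" for c b0
    using tendsto_scaleR[OF tendsto_const iter_tendsto_hat(1)[OF a, of b0], of c]
    by (auto simp: beta_hat_def beta_iter_rescaled[abs_def] intro: limI)
  show "sigma_hat X (c *\<^sub>R y) B lam0 a (c *\<^sub>R b0) = \<bar>c\<bar> * sigma_hat X y bhat lam0 a b0"
    if "lasso_path X (c *\<^sub>R y) B" for c b0 B
  proof -
    \<comment> \<open>Path independence exchanges \<open>B\<close> for the rescaled path, along
      which all iterates scale exactly.\<close>
    have "sigma_iter X (c *\<^sub>R y) B lam0 a (c *\<^sub>R b0) = (\<lambda>k. \<bar>c\<bar> * sigma_iter X y bhat lam0 a b0 k)"
      using sigma_iter_path_unique[OF that resc, of lam0 a "c *\<^sub>R b0"] assms(1) a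
      by (simp add: fun_eq_iff sigma_iter_def beta_iter_rescaled sigma_update_scaleR)
    then show ?thesis
      using tendsto_mult[OF tendsto_const iter_tendsto_hat(2)[OF a, of b0], of "\<bar>c\<bar>"]
      by (simp add: sigma_hat_def limI)
  qed
  have scaled: "(beta_hat X (c *\<^sub>R y) B lam0 a b1, sigma_hat X (c *\<^sub>R y) B lam0 a b1)
      = (c *\<^sub>R beta_hat X y bhat lam0 a b0, \<bar>c\<bar> * sigma_hat X y bhat lam0 a b0)"
    if unique: "\<exists>!m. m \<in> scaled_argmin X y lam0 a" and "c \<noteq> 0" "lasso_path X (c *\<^sub>R y) B"
      "X *v b0 \<noteq> y" "X *v b1 \<noteq> c *\<^sub>R y" for c b0 b1 B
  proof -
    \<comment> \<open>With a second instance for the scaled response, both pairs of limits lie in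
      singleton argmin sets that correspond under scaling.\<close>
    interpret scaled: scaled_lasso X "c *\<^sub>R y" B lam0 a
      by unfold_locales (use assms that in auto)
    obtain m where m: "scaled_argmin X y lam0 a = {m}"
      using unique by blast
    have "(beta_hat X y bhat lam0 a b0, sigma_hat X y bhat lam0 a b0) = m"
      using hat_in_argmin[OF a, of b0] that m by auto
    moreover have "scaled_argmin X (c *\<^sub>R y) lam0 a = {(c *\<^sub>R fst m, \<bar>c\<bar> * snd m)}"
      using scaled_argmin_scaleR[OF \<open>c \<noteq> 0\<close>, of X y] m by (simp add: case_prod_beta)
    ultimately show ?thesis
      using scaled.hat_in_argmin[OF a, of b1] that by auto
  qed
  show "beta_hat X (c *\<^sub>R y) B lam0 a b1 = c *\<^sub>R beta_hat X y bhat lam0 a b0"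
    "sigma_hat X (c *\<^sub>R y) B lam0 a b1 = \<bar>c\<bar> * sigma_hat X y bhat lam0 a b0"
    if "\<exists>!m. m \<in> scaled_argmin X y lam0 a" "c \<noteq> 0" "lasso_path X (c *\<^sub>R y) B"
      "X *v b0 \<noteq> y" "X *v b1 \<noteq> c *\<^sub>R y" for c b0 b1 B
    using scaled[OF that] by simp_all
qed

end
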